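(* Let $0\le n\le N-1$ and assume that $(h^n_{i,j},u^n_{i,j},v^n_{i,j})$ is known with $h^n_{i,j}>0$ for each $(i,j)$. Consider the scheme described in the context, with stabilisation terms $q^{n+1}_{i,j}=\eta\Delta t(\eth_x\phi^{n+1}_{i,j}-\omega v^n_{i,j})$ and $r^{n+1}_{i,j}=\eta\Delta t(\eth_y\phi^{n+1}_{i,j}+\omega u^n_{i,j})$, $\eta>0$. Then, under the (implicit) time-step restriction that for all $(i,j)$ $$\Delta t\Bigl(\frac2{\Delta x}+\frac2{\Delta y}\Bigr)\Bigl(\max\{|u^n_{i,j}|,|u^n_{i+1,j}|\}+\sqrt{\tfrac{\eta}{\max\{h^{n+1}_{i,j},h^{n+1}_{i+1,j}\}}}\;\Lambda^{n+1}_{i+\frac12,j}\Bigr)<\min\Bigl\{1,\frac{\min\{h^n_{i,j},h^n_{i+1,j}\}}{\max\{h^{n+1}_{i,j},h^{n+1}_{i+1,j}\}}\Bigr\},$$ $$\Delta t\Bigl(\frac2{\Delta x}+\frac2{\Delta y}\Bigr)\Bigl(\max\{|v^n_{i,j}|,|v^n_{i,j+1}|\}+\sqrt{\tfrac{\eta}{\max\{h^{n+1}_{i,j},h^{n+1}_{i,j+1}\}}}\;\Lambda^{n+1}_{i,j+\frac12}\Bigr)<\min\Bigl\{1,\frac{\min\{h^n_{i,j},h^n_{i,j+1}\}}{\max\{h^{n+1}_{i,j},h^{n+1}_{i,j+1}\}}\Bigr\},$$ there exists a solution $(h^{n+1}_{i,j},u^{n+1}_{i,j},v^{n+1}_{i,j})$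 of the scheme such that $h^{n+1}_{i,j}>0$ for each $(i,j)$. In particular, if $h^0_{i,j}>0$ for each $(i,j)$ (and the restriction holds at every time step), then $h^n_{i,j}>0$ for each $(i,j)$ and each $1\le n\le N$.
   Context: **Setting.** $\Omega$ is the two-dimensional torus, partitioned (periodic boundary conditions) into a uniform rectangular mesh of cells $K_{i,j}=[x_{i-\frac12},x_{i+\frac12}]\times[y_{j-\frac12},y_{j+\frac12}]$ with constant space steps $\Delta x,\Delta y>0$; the indices $(i,j)$ are periodic. The mesh size $\delta_{\mathcal T}=\max_{i,j}\operatorname{diam}(K_{i,j})$ is supposed to lie in $(0,\delta_0]$ for a sufficiently small $\delta_0$. $T>0$, and $0=t^0<\dots<t^N=T$ has constant step $\Delta t$. $g>0$ is the gravitational acceleration, $\omega\in\mathbb R$ is the Coriolis parameter, $b\in W^{2,\infty}(\Omega)$ is the bottom topography, and $h_0>0$, $u_0$, $v_0$ in $L^\infty(\Omega)$ are the initial data. **Notation.** For a grid function $z=(z_{i,j})$: $\{\{z\}\}_{i+\frac12,j}=\frac12(z_{i,j}+z_{i+1,j})$, $\{\{z\}\}_{i,j+\frac12}=\frac12(z_{i,j}+z_{i,j+1})$; $\eth_xz_{i,j}=\frac{1}{\Delta x}(\{\{z\}\}_{i+\frac12,j}-\{\{z\}\}_{i-\frac12,j})$, $\eth_yz_{i,j}=\frac{1}{\Delta y}(\{\{z\}\}_{i,j+\frac12}-\{\{z\}\}_{i,j-\frac12})$. The cell averages are $b_{i,j}=\frac1{\Delta x\Delta y}\int_{K_{i,j}}b$,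 and likewise $h^0_{i,j},u^0_{i,j},v^0_{i,j}$ are the cell averages of $h_0,u_0,v_0$. **Scheme.** For $0\le n\le N-1$: $$\frac{h^{n+1}_{i,j}-h^n_{i,j}}{\Delta t}+\frac{F^{n+1}_{i+\frac12,j}-F^{n+1}_{i-\frac12,j}}{\Delta x}+\frac{G^{n+1}_{i,j+\frac12}-G^{n+1}_{i,j-\frac12}}{\Delta y}=0,$$ $$\frac{h^{n+1}_{i,j}u^{n+1}_{i,j}-h^n_{i,j}u^n_{i,j}}{\Delta t}+\frac{F^{n+1}_{i+\frac12,j}u^n_{i+\frac12,j}-F^{n+1}_{i-\frac12,j}u^n_{i-\frac12,j}}{\Delta x}+\frac{G^{n+1}_{i,j+\frac12}u^n_{i,j+\frac12}-G^{n+1}_{i,j-\frac12}u^n_{i,j-\frac12}}{\Delta y}+h^{n+1}_{i,j}\eth_x\phi^{n+1}_{i,j}=\omega h^{n+1}_{i,j}v^n_{i,j}-\omega r^{n+1}_{i,j},$$ $$\frac{h^{n+1}_{i,j}v^{n+1}_{i,j}-h^n_{i,j}v^n_{i,j}}{\Delta t}+\frac{F^{n+1}_{i+\frac12,j}v^n_{i+\frac12,j}-F^{n+1}_{i-\frac12,j}v^n_{i-\frac12,j}}{\Delta x}+\frac{G^{n+1}_{i,j+\frac12}v^n_{i,j+\frac12}-G^{n+1}_{i,j-\frac12}v^n_{i,j-\frac12}}{\Delta y}+h^{n+1}_{i,j}\eth_y\phi^{n+1}_{i,j}=-\omega h^{n+1}_{i,j}u^n_{i,j}+\omega q^{n+1}_{i,j}.$$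 Here $\phi^{n}_{i,j}=g(h^{n}_{i,j}+b_{i,j})$, the fluxes are $$F^{n+1}_{i+\frac12,j}=\{\{h^{n+1}u^n\}\}_{i+\frac12,j}-\{\{q^{n+1}\}\}_{i+\frac12,j},\qquad G^{n+1}_{i,j+\frac12}=\{\{h^{n+1}v^n\}\}_{i,j+\frac12}-\{\{r^{n+1}\}\}_{i,j+\frac12},$$ and the edge velocities are upwind: for $w=u,v$, $w^n_{i+\frac12,j}=w^n_{i,j}$ if $F^{n+1}_{i+\frac12,j}\ge0$ and $w^n_{i+1,j}$ otherwise; $w^n_{i,j+\frac12}=w^n_{i,j}$ if $G^{n+1}_{i,j+\frac12}\ge0$ and $w^n_{i,j+1}$ otherwise. **Quantities in the time-step restriction.** $$\Lambda^{n+1}_{i+\frac12,j}=\sqrt{\max\{|\eth_x\phi^{n+1}_{i,j}-\omega v^n_{i,j}|,\,|\eth_x\phi^{n+1}_{i+1,j}-\omega v^n_{i+1,j}|\}},\qquad \Lambda^{n+1}_{i,j+\frac12}=\sqrt{\max\{|\eth_y\phi^{n+1}_{i,j}+\omega u^n_{i,j}|,\,|\eth_y\phi^{n+1}_{i,j+1}+\omega u^n_{i,j+1}|\}}.$$ The restriction is implicit: the $h^{n+1}$ and $\phi^{n+1}$ occurring in it are the water height and potential at $t^{n+1}$ determined by the mass balance equation of the scheme (with the stated $q^{n+1},r^{n+1}$ this is a linear system for $\phi^{n+1}$). *)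

theory Defs
  imports "HOL-Analysis.Analysis"
begin

section \<open>Function spaces on the torus\<close>

text \<open>
  Functions on the torus with side lengths \<open>Lx\<close>, \<open>Ly\<close> are doubly periodic functions on the plane;
  integrals over the torus are Lebesgue integrals over the fundamental rectangle.
\<close>

definition torus_dom :: "real \<Rightarrow> real \<Rightarrow> (real \<times> real) set" where
  "torus_dom Lx Ly = {0..Lx} \<times> {0..Ly}"

definition torus_periodic :: "real \<Rightarrow> real \<Rightarrow> (real \<times> real \<Rightarrow> real) \<Rightarrow> bool" where
  "torus_periodic Lx Ly f \<longleftrightarrow> (\<forall>x y. f (x + Lx, y) = f (x, y) \<and> f (x, y + Ly) = f (x, y))"

definition L_infty :: "real \<Rightarrow> real \<Rightarrow> (real \<times> real \<Rightarrow> real) \<Rightarrow> bool" where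
  "L_infty Lx Ly f \<longleftrightarrow> torus_periodic Lx Ly f \<and> f \<in> borel_measurable lebesgue \<and>
     (\<exists>C. AE z in lebesgue. \<bar>f z\<bar> \<le> C)"

text \<open>
  \<open>D\<close> is the family of all partial derivatives of the periodic \<open>C\<^sup>\<infinity>\<close> test function \<open>D 0 0\<close>:
  \<open>D m n\<close> is its derivative of order \<open>m\<close> in \<open>x\<close> and \<open>n\<close> in \<open>y\<close>.
\<close>

definition test_function :: "real \<Rightarrow> real \<Rightarrow> (nat \<Rightarrow> nat \<Rightarrow> real \<times> real \<Rightarrow> real) \<Rightarrow> bool" where
  "test_function Lx Ly D \<longleftrightarrow> torus_periodic Lx Ly (D 0 0) \<and>
     (\<forall>m n. continuous_on UNIV (D m n) \<and>
       (\<forall>x y. ((\<lambda>s. D m n (s, y)) has_real_derivative D (Suc m) n (x, y)) (at x) \<and>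
              ((\<lambda>s. D m n (x, s)) has_real_derivative D m (Suc n) (x, y)) (at y)))"

definition weak_derivative ::
    "real \<Rightarrow> real \<Rightarrow> nat \<Rightarrow> nat \<Rightarrow> (real \<times> real \<Rightarrow> real) \<Rightarrow> (real \<times> real \<Rightarrow> real) \<Rightarrow> bool" where
  "weak_derivative Lx Ly m n f w \<longleftrightarrow> (\<forall>D. test_function Lx Ly D \<longrightarrow>
     (LINT z : torus_dom Lx Ly | lebesgue. f z * D m n z) =
       (- 1) ^ (m + n) * (LINT z : torus_dom Lx Ly | lebesgue. w z * D 0 0 z))"

definition W_infty :: "nat \<Rightarrow> real \<Rightarrow> real \<Rightarrow> (real \<times> real \<Rightarrow> real) \<Rightarrow> bool" where
  "W_infty k Lx Ly f \<longleftrightarrow> L_infty Lx Ly f \<and>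
     (\<forall>m n. m + n \<le> k \<longrightarrow> (\<exists>w. L_infty Lx Ly w \<and> weak_derivative Lx Ly m n f w))"

section \<open>Mesh and data\<close>

record swe =
  cells_x :: nat
  cells_y :: nat
  \<Delta>x :: real
  \<Delta>y :: real
  final_time :: real
  time_steps :: nat
  grav :: real
  coriolis :: real
  stab :: real                                \<comment> \<open>the parameter \<open>\<eta>\<close>\<close>
  bottom :: "real \<times> real \<Rightarrow> real"
  h_init :: "real \<times> real \<Rightarrow> real"
  u_init :: "real \<times> real \<Rightarrow> real"
  v_init :: "real \<times> real \<Rightarrow> real"

definition \<Delta>t :: "swe \<Rightarrow> real" where
  "\<Delta>t S = final_time S / real (time_steps S)"

definition Lx :: "swe \<Rightarrow> real" where "Lx S = real (cells_x S) * \<Delta>x S"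
definition Ly :: "swe \<Rightarrow> real" where "Ly S = real (cells_y S) * \<Delta>y S"

text \<open>
  Cells are indexed by all pairs of integers, modulo the numbers of cells, with
  \<open>x\<^bsub>i-1/2\<^esub> = i \<Delta>x\<close> and \<open>y\<^bsub>j-1/2\<^esub> = j \<Delta>y\<close>.
\<close>

definition cell :: "swe \<Rightarrow> int \<Rightarrow> int \<Rightarrow> (real \<times> real) set" where
  "cell S i j = {of_int i * \<Delta>x S .. of_int (i + 1) * \<Delta>x S} \<times>
                {of_int j * \<Delta>y S .. of_int (j + 1) * \<Delta>y S}"

definition mesh_size :: "swe \<Rightarrow> real" where
  "mesh_size S = Max ((\<lambda>(i, j). diameter (cell S i j)) `
                       ({0..<int (cells_x S)} \<times> {0..<int (cells_y S)}))"

definition swe_setting :: "swe \<Rightarrow> bool" where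
  "swe_setting S \<longleftrightarrow>
     cells_x S \<ge> 1 \<and> cells_y S \<ge> 1 \<and> \<Delta>x S > 0 \<and> \<Delta>y S > 0 \<and>
     final_time S > 0 \<and> time_steps S \<ge> 1 \<and> grav S > 0 \<and> stab S > 0 \<and>
     W_infty 2 (Lx S) (Ly S) (bottom S) \<and>
     L_infty (Lx S) (Ly S) (h_init S) \<and> (AE z in lebesgue. h_init S z > 0) \<and>
     L_infty (Lx S) (Ly S) (u_init S) \<and> L_infty (Lx S) (Ly S) (v_init S)"

section \<open>Grid functions\<close>

type_synonym grid = "int \<Rightarrow> int \<Rightarrow> real"

definition grid_periodic :: "swe \<Rightarrow> grid \<Rightarrow> bool" where
  "grid_periodic S z \<longleftrightarrow>
     (\<forall>i j. z (i + int (cells_x S)) j = z i j \<and> z i (j + int (cells_y S)) = z i j)"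

definition grid_pos :: "grid \<Rightarrow> bool" where
  "grid_pos z \<longleftrightarrow> (\<forall>i j. z i j > 0)"

definition cell_average :: "swe \<Rightarrow> (real \<times> real \<Rightarrow> real) \<Rightarrow> grid" where
  "cell_average S f i j = 1 / (\<Delta>x S * \<Delta>y S) * (LINT z : cell S i j | lebesgue. f z)"

text \<open>
  Edge quantities carry the index of the cell on the lower side: the value at \<open>i j\<close> of an
  \<open>x\<close>-edge function is the one at \<open>(i+1/2, j)\<close>, of a \<open>y\<close>-edge function the one at \<open>(i, j+1/2)\<close>.
\<close>

definition avg_x :: "grid \<Rightarrow> grid" where
  "avg_x z i j = (z i j + z (i + 1) j) / 2"

definition avg_y :: "grid \<Rightarrow> grid" where
  "avg_y z i j = (z i j + z i (j + 1)) / 2"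

definition eth_x :: "swe \<Rightarrow> grid \<Rightarrow> grid" where
  "eth_x S z i j = (avg_x z i j - avg_x z (i - 1) j) / \<Delta>x S"

definition eth_y :: "swe \<Rightarrow> grid \<Rightarrow> grid" where
  "eth_y S z i j = (avg_y z i j - avg_y z i (j - 1)) / \<Delta>y S"

section \<open>The scheme\<close>

text \<open>Below \<open>h u v\<close> is the state at \<open>t\<^sup>n\<close> and \<open>h' u' v'\<close> the state at \<open>t\<^bsup>n+1\<^esup>\<close>.\<close>

definition potential :: "swe \<Rightarrow> grid \<Rightarrow> grid" where
  "potential S h i j = grav S * (h i j + cell_average S (bottom S) i j)"

definition stab_q :: "swe \<Rightarrow> grid \<Rightarrow> grid \<Rightarrow> grid" where
  "stab_q S v h' i j = stab S * \<Delta>t S * (eth_x S (potential S h') i j - coriolis S * v i j)"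

definition stab_r :: "swe \<Rightarrow> grid \<Rightarrow> grid \<Rightarrow> grid" where
  "stab_r S u h' i j = stab S * \<Delta>t S * (eth_y S (potential S h') i j + coriolis S * u i j)"

definition flux_F :: "swe \<Rightarrow> grid \<Rightarrow> grid \<Rightarrow> grid \<Rightarrow> grid" where
  "flux_F S u v h' i j = avg_x (\<lambda>k l. h' k l * u k l) i j - avg_x (stab_q S v h') i j"

definition flux_G :: "swe \<Rightarrow> grid \<Rightarrow> grid \<Rightarrow> grid \<Rightarrow> grid" where
  "flux_G S u v h' i j = avg_y (\<lambda>k l. h' k l * v k l) i j - avg_y (stab_r S u h') i j"

definition upwind_x :: "grid \<Rightarrow> grid \<Rightarrow> grid" where
  "upwind_x F w i j = (if F i j \<ge> 0 then w i j else w (i + 1) j)"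

definition upwind_y :: "grid \<Rightarrow> grid \<Rightarrow> grid" where
  "upwind_y G w i j = (if G i j \<ge> 0 then w i j else w i (j + 1))"

definition mass_balance :: "swe \<Rightarrow> grid \<Rightarrow> grid \<Rightarrow> grid \<Rightarrow> grid \<Rightarrow> bool" where
  "mass_balance S h u v h' \<longleftrightarrow>
     (let F = flux_F S u v h'; G = flux_G S u v h' in
      \<forall>i j. (h' i j - h i j) / \<Delta>t S + (F i j - F (i - 1) j) / \<Delta>x S
              + (G i j - G i (j - 1)) / \<Delta>y S = 0)"

definition momentum_x :: "swe \<Rightarrow> grid \<Rightarrow> grid \<Rightarrow> grid \<Rightarrow> grid \<Rightarrow> grid \<Rightarrow> bool" where
  "momentum_x S h u v h' u' \<longleftrightarrow>
     (let F = flux_F S u v h'; G = flux_G S u v h'; ux = upwind_x F u; uy = upwind_y G u in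
      \<forall>i j. (h' i j * u' i j - h i j * u i j) / \<Delta>t S
              + (F i j * ux i j - F (i - 1) j * ux (i - 1) j) / \<Delta>x S
              + (G i j * uy i j - G i (j - 1) * uy i (j - 1)) / \<Delta>y S
              + h' i j * eth_x S (potential S h') i j
            = coriolis S * h' i j * v i j - coriolis S * stab_r S u h' i j)"

definition momentum_y :: "swe \<Rightarrow> grid \<Rightarrow> grid \<Rightarrow> grid \<Rightarrow> grid \<Rightarrow> grid \<Rightarrow> bool" where
  "momentum_y S h u v h' v' \<longleftrightarrow>
     (let F = flux_F S u v h'; G = flux_G S u v h'; vx = upwind_x F v; vy = upwind_y G v in
      \<forall>i j. (h' i j * v' i j - h i j * v i j) / \<Delta>t S
              + (F i j * vx i j - F (i - 1) j * vx (i - 1) j) / \<Delta>x S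
              + (G i j * vy i j - G i (j - 1) * vy i (j - 1)) / \<Delta>y S
              + h' i j * eth_y S (potential S h') i j
            = - coriolis S * h' i j * u i j + coriolis S * stab_q S v h' i j)"

definition scheme_step :: "swe \<Rightarrow> grid \<Rightarrow> grid \<Rightarrow> grid \<Rightarrow> grid \<Rightarrow> grid \<Rightarrow> grid \<Rightarrow> bool" where
  "scheme_step S h u v h' u' v' \<longleftrightarrow>
     grid_periodic S h' \<and> grid_periodic S u' \<and> grid_periodic S v' \<and>
     mass_balance S h u v h' \<and> momentum_x S h u v h' u' \<and> momentum_y S h u v h' v'"

section \<open>The time-step restriction\<close>

definition Lambda_x :: "swe \<Rightarrow> grid \<Rightarrow> grid \<Rightarrow> grid" where
  "Lambda_x S v h' i j =
     sqrt (max \<bar>eth_x S (potential S h') i j - coriolis S * v i j\<bar>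
               \<bar>eth_x S (potential S h') (i + 1) j - coriolis S * v (i + 1) j\<bar>)"

definition Lambda_y :: "swe \<Rightarrow> grid \<Rightarrow> grid \<Rightarrow> grid" where
  "Lambda_y S u h' i j =
     sqrt (max \<bar>eth_y S (potential S h') i j + coriolis S * u i j\<bar>
               \<bar>eth_y S (potential S h') i (j + 1) + coriolis S * u i (j + 1)\<bar>)"

text \<open>
  The quotients and the root of \<open>\<eta> / max {\<dots>}\<close> are meaningful only if \<open>max {\<dots>} > 0\<close>. This is part
  of the restriction and has to be spelled out, since HOL's \<open>sqrt\<close> is negative on negative
  arguments. (With any nonnegative convention for the root it would follow from the inequality,
  whose right-hand side is nonpositive when the maximum is nonpositive, as \<open>x / 0 = 0\<close>.)
\<close>

definition time_step_restriction :: "swe \<Rightarrow> grid \<Rightarrow> grid \<Rightarrow> grid \<Rightarrow> grid \<Rightarrow> bool" where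
  "time_step_restriction S h u v h' \<longleftrightarrow> (\<forall>i j.
     (let H = max (h' i j) (h' (i + 1) j) in
        H > 0 \<and>
        \<Delta>t S * (2 / \<Delta>x S + 2 / \<Delta>y S) *
          (max \<bar>u i j\<bar> \<bar>u (i + 1) j\<bar> + sqrt (stab S / H) * Lambda_x S v h' i j)
        < min 1 (min (h i j) (h (i + 1) j) / H)) \<and>
     (let H = max (h' i j) (h' i (j + 1)) in
        H > 0 \<and>
        \<Delta>t S * (2 / \<Delta>x S + 2 / \<Delta>y S) *
          (max \<bar>v i j\<bar> \<bar>v i (j + 1)\<bar> + sqrt (stab S / H) * Lambda_y S u h' i j)
        < min 1 (min (h i j) (h i (j + 1)) / H)))"

text \<open>
  The water height at \<open>t\<^bsup>n+1\<^esup>\<close> determined by the mass balance, a linear system for \<open>h'\<close>. Its solvability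
  need not be assumed alongside the restriction: whatever \<open>THE\<close> denotes, the restriction for it
  bounds \<open>\<Delta>t (2/\<Delta>x + 2/\<Delta>y) |u|\<close> and \<open>\<Delta>t (2/\<Delta>x + 2/\<Delta>y) |v|\<close> by 1, and these bounds on the data
  at \<open>t\<^sup>n\<close> make the system uniquely solvable (its matrix is then positive definite, though not
  symmetric).
\<close>

definition next_height :: "swe \<Rightarrow> grid \<Rightarrow> grid \<Rightarrow> grid \<Rightarrow> grid" where
  "next_height S h u v = (THE h'. grid_periodic S h' \<and> mass_balance S h u v h')"

end

theory Submission
  imports Defs "HOL-Library.Function_Algebras"
begin

text \<open>
  The velocities at the new time are explicit once the new height \<open>h'\<close> is known and positive: the
  momentum equations only have to be divided by \<open>h'\<close>. So two things are needed, that the mass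
  balance has a solution and that the time-step restriction makes this solution positive.

  \<^emph>\<open>Positivity\<close> (\<open>mass_balance_imp_pos\<close>). Suppose \<open>h' \<le> 0\<close> in some cell. The restriction requires
  the larger of two neighbouring heights to be positive, so all four neighbours are positive.
  In \<open>F\<^bsub>i+1/2\<^esub> - F\<^bsub>i-1/2\<^esub>\<close> the contribution of \<open>h'\<close> in the bad cell cancels, because the
  interpolation is centred; what is left of each flux is bounded by \<open>H (U + \<eta> \<Delta>t \<Lambda>\<^sup>2 / H)\<close>, where
  \<open>H\<close> is the height of the neighbour and \<open>U\<close> the larger velocity. With \<open>s = \<Lambda> \<surd>(\<eta>/H)\<close> the second term
  is \<open>\<Delta>t s\<^sup>2\<close>, quadratic in \<open>s\<close>, while the restriction is linear in \<open>s\<close>. It is here that the mesh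
  must be small: if \<open>2/\<Delta>x + 2/\<Delta>y \<ge> 1\<close>, the restriction gives \<open>\<Delta>t s \<le> 1\<close>, hence
  \<open>\<Delta>t s\<^sup>2 \<le> s\<close>, and each of the four outer fluxes is less than \<open>h / (\<Delta>t (2/\<Delta>x + 2/\<Delta>y))\<close>. Together
  they remove less mass than the cell contained, which contradicts \<open>h' \<le> 0\<close>.

  \<^emph>\<open>Solvability\<close> (\<open>ex1_mass_balance\<close>). The mass balance is a linear system for \<open>h'\<close>. Testing the
  homogeneous system with its solution \<open>z\<close> and summing by parts, the stabilisation contributes
  \<open>\<eta> \<Delta>t g \<Sum> |\<eth> z|\<^sup>2 \<ge> 0\<close>, and the transport terms are at most half of \<open>\<Sum> z\<^sup>2 / \<Delta>t\<close>, because the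
  restriction bounds the velocities by \<open>1 / (\<Delta>t (2/\<Delta>x + 2/\<Delta>y))\<close>. So \<open>z = 0\<close>, and since periodic grid
  functions form a space of finite dimension, injectivity gives surjectivity. The bound on the
  velocities follows from the restriction for any height whatsoever, in particular for the value of
  \<open>next_height\<close> before this value is known to solve the mass balance.
\<close>

section \<open>Positivity of the water height\<close>

text \<open>
  A cell contains a horizontal segment of length \<open>\<Delta>x\<close>, so the mesh size bounds \<open>\<Delta>x\<close>.
\<close>

lemma mesh_factor_ge_1:
  assumes "swe_setting S" "mesh_size S \<le> 1"
  shows "2 / \<Delta>x S + 2 / \<Delta>y S \<ge> 1"
proof -
  have pos: "\<Delta>x S > 0" "\<Delta>y S > 0" "cells_x S \<ge> 1" "cells_y S \<ge> 1"
    using assms(1) by (auto simp: swe_setting_def)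
  have bnd: "bounded (cell S 0 0)"
    unfolding cell_def by (intro bounded_Times bounded_closed_interval)
  have "\<Delta>x S = dist (0::real, 0::real) (\<Delta>x S, 0)"
    using pos by (simp add: dist_Pair_Pair dist_real_def)
  also have "\<dots> \<le> diameter (cell S 0 0)"
    by (rule diameter_bounded_bound[OF bnd]) (use pos in \<open>auto simp: cell_def\<close>)
  also have "\<dots> \<le> mesh_size S"
    unfolding mesh_size_def by (rule Max_ge) (use pos in \<open>auto intro!: rev_image_eqI[of "(0,0)"]\<close>)
  finally have "\<Delta>x S \<le> 1" using assms(2) by simp
  then have "2 / \<Delta>x S \<ge> 2" using pos by (simp add: field_simps)
  moreover have "2 / \<Delta>y S > 0" using pos by simp
  ultimately show ?thesis by linarith
qed

text \<open>
  This converts the restriction, linear in \<open>s = \<surd>(\<eta>/H) \<surd>m\<close>, into a bound on a flux that contains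
  \<open>\<eta> \<tau> m = H \<tau> s\<^sup>2\<close>: the restriction and \<open>C \<ge> 1\<close> give \<open>\<tau> s \<le> \<tau> C s \<le> 1\<close>, so that \<open>\<tau> s\<^sup>2 \<le> s\<close>.
\<close>

lemma edge_flux_bound:
  fixes \<tau> C H \<eta> U m \<mu> :: real
  assumes "\<tau> > 0" "C \<ge> 1" "H > 0" "\<eta> > 0" "m \<ge> 0" "U \<ge> 0"
    and cfl: "\<tau> * C * (U + sqrt (\<eta> / H) * sqrt m) < min 1 (\<mu> / H)"
  shows "H * U + \<eta> * \<tau> * m < \<mu> / (\<tau> * C)"
proof -
  define s where "s = sqrt (\<eta> / H) * sqrt m"
  have s0: "s \<ge> 0" using assms by (simp add: s_def)
  have s2: "s * s = \<eta> * m / H"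
    using assms by (simp add: s_def real_sqrt_mult[symmetric] mult.assoc[symmetric])
  have "\<tau> * s \<le> \<tau> * C * s"
    using assms s0 by (simp add: mult_right_mono)
  also have "\<dots> \<le> \<tau> * C * (U + s)"
    using assms by (intro mult_left_mono) auto
  finally have "\<tau> * s \<le> 1" using cfl by (simp add: s_def)
  then have "\<tau> * s * s \<le> 1 * s" using s0 by (intro mult_right_mono)
  have "H * U + \<eta> * \<tau> * m = H * (U + \<tau> * s * s)"
    using s2 assms(3) by (simp add: mult.assoc) (simp add: field_simps)
  also have "\<dots> \<le> H * (U + s)"
    using \<open>\<tau> * s * s \<le> 1 * s\<close> assms(3) by (intro mult_left_mono) auto
  finally have le: "H * U + \<eta> * \<tau> * m \<le> H * (U + s)" .
  have "\<tau> * C * (U + s) < \<mu> / H" using cfl by (simp add: s_def)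
  then have "H * (U + s) < \<mu> / (\<tau> * C)"
    using assms by (simp add: field_simps)
  with le show ?thesis by linarith
qed

text \<open>
  The flux through an edge of a cell without the part \<open>k w / 2\<close> that the cell itself contributes,
  when \<open>k\<close> is the nonpositive new height of the cell. Primes mark the neighbour, \<open>k0\<close> and \<open>k0'\<close> are
  the old heights, and \<open>\<eta> \<tau> a\<close> and \<open>\<eta> \<tau> a'\<close> are the stabilisation terms.
\<close>

lemma outer_flux_bound:
  fixes \<tau> C \<eta> w w' a a' k k' k0 k0' :: real
  assumes "\<tau> > 0" "C \<ge> 1" "\<eta> > 0" "max k k' > 0" "k \<le> 0"
    and cfl: "\<tau> * C * (max \<bar>w\<bar> \<bar>w'\<bar> + sqrt (\<eta> / max k k') * sqrt (max \<bar>a\<bar> \<bar>a'\<bar>))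
              < min 1 (min k0 k0' / max k k')"
  shows "\<bar>k' * w' / 2 - (\<eta> * \<tau> * a + \<eta> * \<tau> * a') / 2\<bar> < k0 / (\<tau> * C)"
proof -
  define m where "m = max \<bar>a\<bar> \<bar>a'\<bar>"
  define U where "U = max \<bar>w\<bar> \<bar>w'\<bar>"
  have k: "max k k' = k'" "k' > 0" using assms by auto
  have b: "k' * U + \<eta> * \<tau> * m < min k0 k0' / (\<tau> * C)"
    by (rule edge_flux_bound) (use assms k in \<open>auto simp: m_def U_def\<close>)
  have e: "\<eta> * \<tau> > 0" using assms by simp
  have "\<bar>k' * w'\<bar> \<le> k' * U" using k by (simp add: abs_mult U_def)
  moreover have "\<bar>\<eta> * \<tau> * a\<bar> \<le> \<eta> * \<tau> * m" "\<bar>\<eta> * \<tau> * a'\<bar> \<le> \<eta> * \<tau> * m"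
    using e assms by (auto simp: abs_mult m_def)
  moreover have "\<bar>p / 2 - (x + y) / 2\<bar> \<le> P + M"
    if "\<bar>p\<bar> \<le> P" "\<bar>x\<bar> \<le> M" "\<bar>y\<bar> \<le> M" for p x y P M :: real
    using that by argo
  ultimately have "\<bar>k' * w' / 2 - (\<eta> * \<tau> * a + \<eta> * \<tau> * a') / 2\<bar> \<le> k' * U + \<eta> * \<tau> * m"
    by blast
  moreover have "min k0 k0' / (\<tau> * C) \<le> k0 / (\<tau> * C)"
    using assms by (intro divide_right_mono) auto
  ultimately show ?thesis using b by linarith
qed

text \<open>
  The contributions \<open>h'\<^bsub>i,j\<^esub> u\<^bsub>i,j\<^esub> / 2\<close> and \<open>h'\<^bsub>i,j\<^esub> v\<^bsub>i,j\<^esub> / 2\<close> of a cell to the fluxes through its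
  opposite edges are equal, so they drop out of the balance of this cell, and the bounds on the
  outer parts of the fluxes apply.
\<close>

lemma mass_balance_imp_pos:
  assumes pos: "\<Delta>t S > 0" "\<Delta>x S > 0" "\<Delta>y S > 0" "stab S > 0"
    and C1: "2 / \<Delta>x S + 2 / \<Delta>y S \<ge> 1"
    and mb: "mass_balance S h u v h'" and h: "grid_pos h"
    and cfl: "time_step_restriction S h u v h'"
  shows "grid_pos h'"
  unfolding grid_pos_def
proof (intro allI, rule ccontr)
  fix i j
  assume "\<not> h' i j > 0"
  then have np: "h' i j \<le> 0" by simp
  define C where "C = 2 / \<Delta>x S + 2 / \<Delta>y S"
  define D where "D = h i j / (\<Delta>t S * C)"
  define F where "F = flux_F S u v h'"
  define G where "G = flux_G S u v h'"
  define a where "a k l = eth_x S (potential S h') k l - coriolis S * v k l" for k l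
  define c where "c k l = eth_y S (potential S h') k l + coriolis S * u k l" for k l
  have rx: "max (h' k l) (h' (k + 1) l) > 0"
      "\<Delta>t S * C * (max \<bar>u k l\<bar> \<bar>u (k + 1) l\<bar> + sqrt (stab S / max (h' k l) (h' (k + 1) l))
          * sqrt (max \<bar>a k l\<bar> \<bar>a (k + 1) l\<bar>))
        < min 1 (min (h k l) (h (k + 1) l) / max (h' k l) (h' (k + 1) l))"
    and ry: "max (h' k l) (h' k (l + 1)) > 0"
      "\<Delta>t S * C * (max \<bar>v k l\<bar> \<bar>v k (l + 1)\<bar> + sqrt (stab S / max (h' k l) (h' k (l + 1)))
          * sqrt (max \<bar>c k l\<bar> \<bar>c k (l + 1)\<bar>))
        < min 1 (min (h k l) (h k (l + 1)) / max (h' k l) (h' k (l + 1)))" for k l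
    using cfl unfolding time_step_restriction_def Let_def C_def a_def c_def Lambda_x_def Lambda_y_def
    by blast+
  have Feq: "F k l = h' k l * u k l / 2 + h' (k + 1) l * u (k + 1) l / 2
      - (stab S * \<Delta>t S * a k l + stab S * \<Delta>t S * a (k + 1) l) / 2"
    and Geq: "G k l = h' k l * v k l / 2 + h' k (l + 1) * v k (l + 1) / 2
      - (stab S * \<Delta>t S * c k l + stab S * \<Delta>t S * c k (l + 1)) / 2" for k l
    by (simp_all only: F_def G_def flux_F_def flux_G_def avg_x_def avg_y_def stab_q_def stab_r_def
        a_def c_def add_divide_distrib)
  note outer = outer_flux_bound[OF pos(1) C1[folded C_def] pos(4) _ np]
  have Fp: "\<bar>F i j - h' i j * u i j / 2\<bar> < D"
    using outer[OF rx[of i j]] unfolding Feq D_def by argo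
  \<comment> \<open>the left and lower edges are those of the neighbour \<open>i - 1\<close> or \<open>j - 1\<close>, with the two cells swapped\<close>
  have Fm: "\<bar>F (i - 1) j - h' i j * u i j / 2\<bar> < D"
  proof -
    have "max (h' i j) (h' (i - 1) j) > 0"
      "\<Delta>t S * C * (max \<bar>u i j\<bar> \<bar>u (i - 1) j\<bar> + sqrt (stab S / max (h' i j) (h' (i - 1) j))
          * sqrt (max \<bar>a i j\<bar> \<bar>a (i - 1) j\<bar>))
        < min 1 (min (h i j) (h (i - 1) j) / max (h' i j) (h' (i - 1) j))"
      using rx[of "i - 1" j] by (simp_all only: max.commute min.commute diff_add_cancel)
    from outer[OF this] show ?thesis unfolding Feq D_def diff_add_cancel by argo
  qed
  have Gp: "\<bar>G i j - h' i j * v i j / 2\<bar> < D"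
    using outer[OF ry[of i j]] unfolding Geq D_def by argo
  have Gm: "\<bar>G i (j - 1) - h' i j * v i j / 2\<bar> < D"
  proof -
    have "max (h' i j) (h' i (j - 1)) > 0"
      "\<Delta>t S * C * (max \<bar>v i j\<bar> \<bar>v i (j - 1)\<bar> + sqrt (stab S / max (h' i j) (h' i (j - 1)))
          * sqrt (max \<bar>c i j\<bar> \<bar>c i (j - 1)\<bar>))
        < min 1 (min (h i j) (h i (j - 1)) / max (h' i j) (h' i (j - 1)))"
      using ry[of i "j - 1"] by (simp_all only: max.commute min.commute diff_add_cancel)
    from outer[OF this] show ?thesis unfolding Geq D_def diff_add_cancel by argo
  qed
  have "F i j - F (i - 1) j < 2 * D" "G i j - G i (j - 1) < 2 * D"
    using Fp Fm Gp Gm by linarith+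
  then have "(F i j - F (i - 1) j) / \<Delta>x S < 2 * D / \<Delta>x S" "(G i j - G i (j - 1)) / \<Delta>y S < 2 * D / \<Delta>y S"
    using pos by (auto intro: divide_strict_right_mono)
  then have "(F i j - F (i - 1) j) / \<Delta>x S + (G i j - G i (j - 1)) / \<Delta>y S < D * C"
    by (simp add: C_def distrib_left mult.commute)
  also have "D * C = h i j / \<Delta>t S"
    using pos C1 by (simp add: D_def C_def)
  finally have "(h' i j - h i j) / \<Delta>t S + h i j / \<Delta>t S > 0"
    using mb unfolding mass_balance_def Let_def F_def[symmetric] G_def[symmetric]
    by (smt (verit))
  then have "h' i j / \<Delta>t S > 0" by (simp add: diff_divide_distrib)
  with np pos show False by (simp add: zero_less_divide_iff)
qed

section \<open>Periodic grid functions\<close>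

lemma periodic_avg_x: "grid_periodic S z \<Longrightarrow> grid_periodic S (avg_x z)"
  unfolding grid_periodic_def avg_x_def by (smt (verit))

lemma periodic_avg_y: "grid_periodic S z \<Longrightarrow> grid_periodic S (avg_y z)"
  unfolding grid_periodic_def avg_y_def by (smt (verit))

lemma periodic_shift:
  assumes "grid_periodic S z"
  shows "grid_periodic S (\<lambda>i j. z (i + a) (j + b))"
proof -
  have "z (i + int (cells_x S) + a) j = z (i + a) j" "z i (j + int (cells_y S) + b) = z i (j + b)" for i j
    using assms unfolding grid_periodic_def by (metis add.assoc add.commute)+
  then show ?thesis by (simp add: grid_periodic_def)
qed

lemma periodic_prev:
  assumes "grid_periodic S z"
  shows "grid_periodic S (\<lambda>i j. z (i - 1) j)" "grid_periodic S (\<lambda>i j. z i (j - 1))"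
  using periodic_shift[OF assms, of "-1" 0] periodic_shift[OF assms, of 0 "-1"] by simp_all

lemma periodic_next:
  assumes "grid_periodic S z"
  shows "grid_periodic S (\<lambda>i j. z (i + 1) j)" "grid_periodic S (\<lambda>i j. z i (j + 1))"
  using periodic_shift[OF assms, of 1 0] periodic_shift[OF assms, of 0 1] by simp_all

lemma periodic_comp2:
  "grid_periodic S z \<Longrightarrow> grid_periodic S w \<Longrightarrow> grid_periodic S (\<lambda>i j. f (z i j) (w i j))"
  by (simp add: grid_periodic_def)

lemma periodic_comp: "grid_periodic S z \<Longrightarrow> grid_periodic S (\<lambda>i j. f (z i j))"
  by (simp add: grid_periodic_def)

lemma periodic_const: "grid_periodic S (\<lambda>i j. c)"
  by (simp add: grid_periodic_def)

lemma periodic_eth: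
  assumes "grid_periodic S z"
  shows "grid_periodic S (eth_x S z)" "grid_periodic S (eth_y S z)"
proof -
  have "grid_periodic S (\<lambda>i j. (avg_x z i j - avg_x z (i - 1) j) / \<Delta>x S)"
    by (intro periodic_comp2[where f = "\<lambda>a b. (a - b) / \<Delta>x S"] periodic_prev periodic_avg_x assms)
  moreover have "grid_periodic S (\<lambda>i j. (avg_y z i j - avg_y z i (j - 1)) / \<Delta>y S)"
    by (intro periodic_comp2[where f = "\<lambda>a b. (a - b) / \<Delta>y S"] periodic_prev periodic_avg_y assms)
  ultimately show "grid_periodic S (eth_x S z)" "grid_periodic S (eth_y S z)"
    by (simp_all add: eth_x_def[abs_def] eth_y_def[abs_def])
qed

text \<open>
  The cell averages of the bottom topography enter the right-hand side of the linear system for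
  the new height. They form a periodic grid function because Lebesgue measure is invariant
  under translation by the periods.
\<close>

lemma integral_lebesgue_translation:
  fixes f :: "'a::euclidean_space \<Rightarrow> real"
  assumes "f \<in> borel_measurable lebesgue"
  shows "(LINT z | lebesgue. f (c + z)) = (LINT z | lebesgue. f z)"
proof -
  have T: "(\<lambda>x::'a. c + (\<Sum>j\<in>Basis. (1 * (x \<bullet> j)) *\<^sub>R j)) = (\<lambda>x. c + x)"
    by (simp add: euclidean_representation)
  have eq: "(lebesgue :: 'a measure) = distr lebesgue lebesgue (\<lambda>x. c + x)"
    and m: "(\<lambda>x::'a. c + x) \<in> lebesgue \<rightarrow>\<^sub>M lebesgue"
    using lebesgue_affine_euclidean[of "\<lambda>_. 1" c] lebesgue_affine_measurable[of "\<lambda>_. 1" c]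
    unfolding T by (simp_all add: density_1)
  have "(LINT z | lebesgue. f z) = (LINT z | distr lebesgue lebesgue (\<lambda>x. c + x). f z)"
    using eq by simp
  also have "\<dots> = (LINT z | lebesgue. f (c + z))"
    by (rule integral_distr[OF m assms])
  finally show ?thesis by simp
qed

lemma set_integral_translation:
  fixes f :: "'a::euclidean_space \<Rightarrow> real"
  assumes "f \<in> borel_measurable lebesgue" "A \<in> sets lebesgue" "\<And>z. f (c + z) = f z"
  shows "(LINT z : (+) c ` A | lebesgue. f z) = (LINT z : A | lebesgue. f z)"
proof -
  have ind: "indicator ((+) c ` A) (c + z) = (indicator A z :: real)" for z
    by (auto simp: indicator_def)
  have [measurable]: "(+) c ` A \<in> sets lebesgue" by (rule lebesgue_sets_translation[OF assms(2)])
  have "(\<lambda>z. indicator ((+) c ` A) z *\<^sub>R f z) \<in> borel_measurable lebesgue"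
    using assms(1) by measurable
  from integral_lebesgue_translation[OF this, of c] show ?thesis
    by (simp add: set_lebesgue_integral_def ind assms(3))
qed

lemma periodic_cell_average:
  assumes "L_infty (Lx S) (Ly S) f"
  shows "grid_periodic S (cell_average S f)"
proof -
  have m: "f \<in> borel_measurable lebesgue" and p: "torus_periodic (Lx S) (Ly S) f"
    using assms by (auto simp: L_infty_def)
  have s: "cell S i j \<in> sets lebesgue" for i j
    unfolding cell_def by (intro lmeasurable_compact fmeasurableD compact_Times compact_Icc)
  have tr: "{a + c .. b + c} \<times> {a' + c' .. b' + c'} = (+) (c, c') ` ({a .. b} \<times> {a' .. b'})"
    for a b c a' b' c' :: real
  proof -
    have "(x, y) \<in> (+) (c, c') ` ({a .. b} \<times> {a' .. b'})"
      if "x \<in> {a + c .. b + c}" "y \<in> {a' + c' .. b' + c'}" for x y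
      by (rule image_eqI[of _ _ "(x - c, y - c')"]) (use that in auto)
    then show ?thesis by auto
  qed
  have cx: "cell S (i + int (cells_x S)) j = (+) (Lx S, 0) ` cell S i j"
   and cy: "cell S i (j + int (cells_y S)) = (+) (0, Ly S) ` cell S i j" for i j
    unfolding cell_def tr[symmetric] by (simp_all add: Lx_def Ly_def distrib_right add_ac)
  have fx: "f ((Lx S, 0) + z) = f z" and fy: "f ((0, Ly S) + z) = f z" for z
    using p by (cases z; simp add: torus_periodic_def add.commute)+
  show ?thesis
    unfolding grid_periodic_def cell_average_def cx cy
    by (simp add: set_integral_translation[where c = "(Lx S, 0)", OF m s fx] 
      set_integral_translation[where c = "(0, Ly S)", OF m s fy])
qed

lemma periodic_potential:
  assumes "swe_setting S" "grid_periodic S h'"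
  shows "grid_periodic S (potential S h')"
proof -
  have "grid_periodic S (cell_average S (bottom S))"
    using assms by (intro periodic_cell_average) (auto simp: swe_setting_def W_infty_def)
  then show ?thesis
    using assms by (simp add: grid_periodic_def potential_def)
qed

lemma periodic_stab:
  assumes "swe_setting S" "grid_periodic S w" "grid_periodic S h'"
  shows "grid_periodic S (stab_q S w h')" "grid_periodic S (stab_r S w h')"
  using periodic_eth[OF periodic_potential[OF assms(1,3)]] assms(2)
  by (simp_all add: grid_periodic_def stab_q_def stab_r_def)

lemma periodic_fluxes:
  assumes "swe_setting S" "grid_periodic S u" "grid_periodic S v" "grid_periodic S h'"
  shows "grid_periodic S (flux_F S u v h')" "grid_periodic S (flux_G S u v h')"
proof -
  have "grid_periodic S (avg_x (\<lambda>k l. h' k l * u k l))" "grid_periodic S (avg_y (\<lambda>k l. h' k l * v k l))"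
    by (intro periodic_avg_x periodic_avg_y periodic_comp2[where f = times] assms)+
  moreover have "grid_periodic S (avg_x (stab_q S v h'))" "grid_periodic S (avg_y (stab_r S u h'))"
    by (intro periodic_avg_x periodic_avg_y periodic_stab assms)+
  ultimately show "grid_periodic S (flux_F S u v h')" "grid_periodic S (flux_G S u v h')"
    by (simp_all add: grid_periodic_def flux_F_def flux_G_def)
qed

lemma periodic_upwind:
  assumes "grid_periodic S F" "grid_periodic S w"
  shows "grid_periodic S (upwind_x F w)" "grid_periodic S (upwind_y F w)"
  using assms periodic_next[OF assms(2)]
  by (simp_all add: grid_periodic_def upwind_x_def upwind_y_def)

section \<open>Energy estimate for the mass balance\<close>

abbreviation cells :: "swe \<Rightarrow> (int \<times> int) set" where
  "cells S \<equiv> {0..<int (cells_x S)} \<times> {0..<int (cells_y S)}"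

lemma sum_int_periodic_shift:
  fixes f :: "int \<Rightarrow> real"
  assumes "\<And>i. f (i + int N) = f i"
  shows "(\<Sum>i\<in>{0..<int N}. f (i + 1)) = (\<Sum>i\<in>{0..<int N}. f i)"
proof (cases "N = 0")
  case False
  have "(\<Sum>i\<in>{0..<int N}. f (i + 1)) = (\<Sum>i\<in>{1..int N}. f i)"
    by (rule sum.reindex_bij_witness[of _ "\<lambda>i. i - 1" "\<lambda>i. i + 1"]) auto
  also have "{1..int N} = insert (int N) {1..<int N}" using False by auto
  also have "sum f (insert (int N) {1..<int N}) = f 0 + sum f {1..<int N}"
    using assms[of 0] by simp
  also have "\<dots> = sum f (insert 0 {1..<int N})" by simp
  also have "insert 0 {1..<int N} = {0..<int N}" using False by auto
  finally show ?thesis .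
qed simp

text \<open>
  Neighbour shifts permute the cells of the torus; this includes directions with only one or two
  cells, where the two neighbours of a cell coincide.
\<close>

lemma sum_cells_shift:
  assumes "grid_periodic S z"
  shows "(\<Sum>(i,j)\<in>cells S. z (i + 1) j) = (\<Sum>(i,j)\<in>cells S. z i j)"
    and "(\<Sum>(i,j)\<in>cells S. z i (j + 1)) = (\<Sum>(i,j)\<in>cells S. z i j)"
proof -
  show "(\<Sum>(i,j)\<in>cells S. z i (j + 1)) = (\<Sum>(i,j)\<in>cells S. z i j)"
    unfolding sum.cartesian_product[symmetric]
    by (intro sum.cong refl sum_int_periodic_shift) (use assms in \<open>simp add: grid_periodic_def\<close>)
  show "(\<Sum>(i,j)\<in>cells S. z (i + 1) j) = (\<Sum>(i,j)\<in>cells S. z i j)"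
    unfolding sum.cartesian_product[symmetric]
    by (subst (1 2) sum.swap, intro sum.cong refl sum_int_periodic_shift)
       (use assms in \<open>simp add: grid_periodic_def\<close>)
qed

lemma eth_x_central: "eth_x S z i j = (z (i + 1) j - z (i - 1) j) / (2 * \<Delta>x S)"
  by (simp add: eth_x_def avg_x_def diff_divide_distrib add_divide_distrib)

lemma eth_y_central: "eth_y S z i j = (z i (j + 1) - z i (j - 1)) / (2 * \<Delta>y S)"
  by (simp add: eth_y_def avg_y_def diff_divide_distrib add_divide_distrib)

text \<open>
  Central differences on the torus are antisymmetric.
\<close>

lemma sum_cells_by_parts:
  assumes "grid_periodic S z" "grid_periodic S w"
  shows "(\<Sum>(i,j)\<in>cells S. z i j * eth_x S w i j) = - (\<Sum>(i,j)\<in>cells S. eth_x S z i j * w i j)"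
    and "(\<Sum>(i,j)\<in>cells S. z i j * eth_y S w i j) = - (\<Sum>(i,j)\<in>cells S. eth_y S z i j * w i j)"
proof -
  have "grid_periodic S (\<lambda>i j. z (i - 1) j * w i j)" "grid_periodic S (\<lambda>i j. z i j * w (i - 1) j)"
    by (intro periodic_comp2[where f = times] periodic_prev assms)+
  from this[THEN sum_cells_shift(1)]
  have "(\<Sum>(i,j)\<in>cells S. z i j * (w (i + 1) j - w (i - 1) j))
      = - (\<Sum>(i,j)\<in>cells S. (z (i + 1) j - z (i - 1) j) * w i j)"
    by (simp add: algebra_simps sum_subtractf split_def)
  then show "(\<Sum>(i,j)\<in>cells S. z i j * eth_x S w i j) = - (\<Sum>(i,j)\<in>cells S. eth_x S z i j * w i j)"
    by (simp add: eth_x_central split_def flip: sum_divide_distrib)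
next
  have "grid_periodic S (\<lambda>i j. z i (j - 1) * w i j)" "grid_periodic S (\<lambda>i j. z i j * w i (j - 1))"
    by (intro periodic_comp2[where f = times] periodic_prev assms)+
  from this[THEN sum_cells_shift(2)]
  have "(\<Sum>(i,j)\<in>cells S. z i j * (w i (j + 1) - w i (j - 1)))
      = - (\<Sum>(i,j)\<in>cells S. (z i (j + 1) - z i (j - 1)) * w i j)"
    by (simp add: algebra_simps sum_subtractf split_def)
  then show "(\<Sum>(i,j)\<in>cells S. z i j * eth_y S w i j) = - (\<Sum>(i,j)\<in>cells S. eth_y S z i j * w i j)"
    by (simp add: eth_y_central split_def flip: sum_divide_distrib)
qed

text \<open>
  Young's inequality \<open>|a c| \<le> (a\<^sup>2 + c\<^sup>2) / 2\<close> for both neighbours \<open>a\<close>, \<open>b\<close> of the value \<open>c\<close>. The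
  weights on the right add up to 1, and shifting the sum over the torus turns \<open>a\<^sup>2\<close> and \<open>b\<^sup>2\<close>
  into \<open>c\<^sup>2\<close>.
\<close>

lemma central_product_bound:
  fixes a b c w \<beta> d :: real
  assumes "\<bar>w\<bar> \<le> \<beta>" "d > 0"
  shows "(a - b) / (2 * d) * (c * w) \<le> \<beta> / d * (c\<^sup>2 / 2 + (a\<^sup>2 + b\<^sup>2) / 4)"
proof -
  have b0: "\<beta> \<ge> 0" using assms by linarith
  have "(a - b) * (c * w) \<le> \<bar>a - b\<bar> * (\<bar>c\<bar> * \<bar>w\<bar>)"
    by (metis abs_ge_self abs_mult)
  also have "\<dots> \<le> \<bar>a - b\<bar> * (\<bar>c\<bar> * \<beta>)"
    using assms by (intro mult_left_mono) auto
  also have "\<dots> = \<beta> * (\<bar>a - b\<bar> * \<bar>c\<bar>)" by simp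
  also have "\<bar>a - b\<bar> * \<bar>c\<bar> \<le> c\<^sup>2 + (a\<^sup>2 + b\<^sup>2) / 2"
  proof -
    have "\<bar>a - b\<bar> * \<bar>c\<bar> \<le> \<bar>a\<bar> * \<bar>c\<bar> + \<bar>b\<bar> * \<bar>c\<bar>"
      by (metis abs_ge_zero abs_triangle_ineq4 distrib_right mult_right_mono)
    moreover have "\<bar>a\<bar> * \<bar>c\<bar> \<le> (a\<^sup>2 + c\<^sup>2) / 2" "\<bar>b\<bar> * \<bar>c\<bar> \<le> (b\<^sup>2 + c\<^sup>2) / 2"
      using sum_squares_bound[of "\<bar>a\<bar>" "\<bar>c\<bar>"] sum_squares_bound[of "\<bar>b\<bar>" "\<bar>c\<bar>"] by auto
    ultimately show ?thesis by (simp add: field_simps)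
  qed
  finally have "(a - b) * (c * w) \<le> \<beta> * (c\<^sup>2 + (a\<^sup>2 + b\<^sup>2) / 2)"
    using b0 by (simp add: mult_left_mono)
  then have "(a - b) * (c * w) / (2 * d) \<le> \<beta> * (c\<^sup>2 + (a\<^sup>2 + b\<^sup>2) / 2) / (2 * d)"
    using assms by (intro divide_right_mono) auto
  then show ?thesis using assms by (simp add: field_simps)
qed

lemma sum_cells_transport_bound:
  assumes z: "grid_periodic S z" and "\<And>i j. \<bar>w i j\<bar> \<le> \<beta>" "\<Delta>x S > 0" "\<Delta>y S > 0"
  shows "(\<Sum>(i,j)\<in>cells S. eth_x S z i j * (z i j * w i j)) \<le> \<beta> / \<Delta>x S * (\<Sum>(i,j)\<in>cells S. (z i j)\<^sup>2)"
    and "(\<Sum>(i,j)\<in>cells S. eth_y S z i j * (z i j * w i j)) \<le> \<beta> / \<Delta>y S * (\<Sum>(i,j)\<in>cells S. (z i j)\<^sup>2)"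
proof -
  have sq: "grid_periodic S (\<lambda>i j. (z i j)\<^sup>2)" by (rule periodic_comp[OF z])
  have "(\<Sum>(i,j)\<in>cells S. eth_x S z i j * (z i j * w i j))
      \<le> (\<Sum>(i,j)\<in>cells S. \<beta> / \<Delta>x S * ((z i j)\<^sup>2 / 2 + ((z (i + 1) j)\<^sup>2 + (z (i - 1) j)\<^sup>2) / 4))"
    unfolding eth_x_central split_def by (intro sum_mono central_product_bound assms)
  also have "\<dots> = \<beta> / \<Delta>x S * (\<Sum>(i,j)\<in>cells S. (z i j)\<^sup>2)"
    using sum_cells_shift(1)[OF sq] sum_cells_shift(1)[OF periodic_prev(1)[OF sq]]
    by (simp add: split_def sum.distrib flip: sum_distrib_left sum_divide_distrib)
  finally show "(\<Sum>(i,j)\<in>cells S. eth_x S z i j * (z i j * w i j)) \<le> \<beta> / \<Delta>x S * (\<Sum>(i,j)\<in>cells S. (z i j)\<^sup>2)" .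
  have "(\<Sum>(i,j)\<in>cells S. eth_y S z i j * (z i j * w i j))
      \<le> (\<Sum>(i,j)\<in>cells S. \<beta> / \<Delta>y S * ((z i j)\<^sup>2 / 2 + ((z i (j + 1))\<^sup>2 + (z i (j - 1))\<^sup>2) / 4))"
    unfolding eth_y_central split_def by (intro sum_mono central_product_bound assms)
  also have "\<dots> = \<beta> / \<Delta>y S * (\<Sum>(i,j)\<in>cells S. (z i j)\<^sup>2)"
    using sum_cells_shift(2)[OF sq] sum_cells_shift(2)[OF periodic_prev(2)[OF sq]]
    by (simp add: split_def sum.distrib flip: sum_distrib_left sum_divide_distrib)
  finally show "(\<Sum>(i,j)\<in>cells S. eth_y S z i j * (z i j * w i j)) \<le> \<beta> / \<Delta>y S * (\<Sum>(i,j)\<in>cells S. (z i j)\<^sup>2)" .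
qed

lemma periodic_mod:
  assumes "grid_periodic S z"
  shows "z i j = z (i mod int (cells_x S)) (j mod int (cells_y S))"
proof -
  have p: "f (i + n * N) = f i" if "\<And>i. f (i + N) = f i" for f :: "int \<Rightarrow> real" and i n N
  proof (induction n rule: int_induct[of _ 0])
    case (step1 n)
    then show ?case using that[of "i + n * N"] by (simp add: algebra_simps)
  next
    case (step2 n)
    then show ?case using that[of "i + (n - 1) * N"] by (simp add: algebra_simps)
  qed simp
  have m: "f i = f (i mod N)" if "\<And>i. f (i + N) = f i" for f :: "int \<Rightarrow> real" and i N
    using p[of f N "i mod N" "i div N", OF that] by simp
  have "z i j = z (i mod int (cells_x S)) j"
    by (rule m[of "\<lambda>i. z i j"]) (use assms in \<open>simp add: grid_periodic_def\<close>)
  also have "\<dots> = z (i mod int (cells_x S)) (j mod int (cells_y S))"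
    by (rule m) (use assms in \<open>simp add: grid_periodic_def\<close>)
  finally show ?thesis .
qed

text \<open>
  The linear part of the mass balance. The sources of \<open>q\<close> and \<open>r\<close> that do not depend on the new
  height, from bottom topography and Coriolis force, are what \<open>stab_q\<close> and \<open>stab_r\<close> give for zero
  height; they belong to the right-hand side.
\<close>

definition height_op :: "swe \<Rightarrow> grid \<Rightarrow> grid \<Rightarrow> grid \<Rightarrow> grid" where
  "height_op S u v z i j =
     z i j / \<Delta>t S
     + eth_x S (\<lambda>k l. z k l * u k l - stab S * \<Delta>t S * grav S * eth_x S z k l) i j
     + eth_y S (\<lambda>k l. z k l * v k l - stab S * \<Delta>t S * grav S * eth_y S z k l) i j"

definition height_rhs :: "swe \<Rightarrow> grid \<Rightarrow> grid \<Rightarrow> grid \<Rightarrow> grid" where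
  "height_rhs S h u v i j =
     h i j / \<Delta>t S + eth_x S (stab_q S v (\<lambda>_ _. 0)) i j + eth_y S (stab_r S u (\<lambda>_ _. 0)) i j"

lemma mass_balance_iff_height_op:
  "mass_balance S h u v h' \<longleftrightarrow> height_op S u v h' = height_rhs S h u v"
proof -
  have q: "stab_q S v h' i j = stab S * \<Delta>t S * grav S * eth_x S h' i j + stab_q S v (\<lambda>_ _. 0) i j" for i j
    unfolding stab_q_def eth_x_central potential_def
    by (simp add: algebra_simps add_divide_distrib diff_divide_distrib)
  have r: "stab_r S u h' i j = stab S * \<Delta>t S * grav S * eth_y S h' i j + stab_r S u (\<lambda>_ _. 0) i j" for i j
    unfolding stab_r_def eth_y_central potential_def
    by (simp add: algebra_simps add_divide_distrib diff_divide_distrib)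
  have F: "(flux_F S u v h' i j - flux_F S u v h' (i - 1) j) / \<Delta>x S
      = eth_x S (\<lambda>k l. h' k l * u k l - stab S * \<Delta>t S * grav S * eth_x S h' k l) i j
        - eth_x S (stab_q S v (\<lambda>_ _. 0)) i j" for i j
    by (simp add: flux_F_def avg_x_def q eth_x_central[of S "stab_q _ _ _"]
        eth_x_central[of S "\<lambda>k l. h' k l * u k l - _ k l"]
        algebra_simps add_divide_distrib diff_divide_distrib)
  have G: "(flux_G S u v h' i j - flux_G S u v h' i (j - 1)) / \<Delta>y S
      = eth_y S (\<lambda>k l. h' k l * v k l - stab S * \<Delta>t S * grav S * eth_y S h' k l) i j
        - eth_y S (stab_r S u (\<lambda>_ _. 0)) i j" for i j
    by (simp add: flux_G_def avg_y_def r eth_y_central[of S "stab_r _ _ _"]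
        eth_y_central[of S "\<lambda>k l. h' k l * v k l - _ k l"]
        algebra_simps add_divide_distrib diff_divide_distrib)
  show ?thesis
    unfolding mass_balance_def Let_def F G fun_eq_iff height_op_def height_rhs_def
      diff_divide_distrib[of "h' _ _" "h _ _"]
    by (intro iff_allI) linarith
qed

lemma periodic_height_op:
  assumes "grid_periodic S u" "grid_periodic S v" "grid_periodic S z"
  shows "grid_periodic S (height_op S u v z)"
proof -
  have "grid_periodic S (eth_x S (\<lambda>k l. z k l * u k l - stab S * \<Delta>t S * grav S * eth_x S z k l))"
    "grid_periodic S (eth_y S (\<lambda>k l. z k l * v k l - stab S * \<Delta>t S * grav S * eth_y S z k l))"
    by (intro periodic_eth periodic_comp2[where f = minus] periodic_comp2[where f = times] periodic_const assms)+
  with assms show ?thesis by (simp add: grid_periodic_def height_op_def)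
qed

lemma periodic_height_rhs:
  assumes "swe_setting S" "grid_periodic S h" "grid_periodic S u" "grid_periodic S v"
  shows "grid_periodic S (height_rhs S h u v)"
  using periodic_eth(1)[OF periodic_stab(1)[OF assms(1,4) periodic_const[of S 0]]]
    periodic_eth(2)[OF periodic_stab(2)[OF assms(1,3) periodic_const[of S 0]]] assms(2)
  by (simp add: grid_periodic_def height_rhs_def)

text \<open>
  The energy estimate: testing \<open>height_op S u v z = 0\<close> with \<open>z\<close> gives
  \<open>\<Sum> z\<^sup>2 / \<Delta>t \<le> \<beta> (1/\<Delta>x + 1/\<Delta>y) \<Sum> z\<^sup>2\<close> with \<open>\<beta> = 1 / (\<Delta>t (2/\<Delta>x + 2/\<Delta>y))\<close>, and the right-hand
  side is half of the left-hand side.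
\<close>

lemma height_op_kernel_trivial:
  assumes S: "swe_setting S" "\<Delta>t S > 0"
    and per: "grid_periodic S u" "grid_periodic S v" "grid_periodic S z"
    and u: "\<And>i j. \<Delta>t S * (2 / \<Delta>x S + 2 / \<Delta>y S) * \<bar>u i j\<bar> \<le> 1"
    and v: "\<And>i j. \<Delta>t S * (2 / \<Delta>x S + 2 / \<Delta>y S) * \<bar>v i j\<bar> \<le> 1"
    and L: "height_op S u v z = (\<lambda>_ _. 0)"
  shows "z = (\<lambda>_ _. 0)"
proof -
  have pos: "\<Delta>x S > 0" "\<Delta>y S > 0" "cells_x S \<ge> 1" "cells_y S \<ge> 1" "grav S > 0" "stab S > 0"
    using S by (auto simp: swe_setting_def)
  define E where "E = (\<Sum>(i,j)\<in>cells S. (z i j)\<^sup>2)"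
  define C where "C = 2 / \<Delta>x S + 2 / \<Delta>y S"
  define \<kappa> where "\<kappa> = stab S * \<Delta>t S * grav S"
  define \<beta> where "\<beta> = 1 / (\<Delta>t S * C)"
  have C0: "C > 0" using pos by (simp add: C_def add_pos_pos)
  have k0: "\<kappa> \<ge> 0" using pos S by (simp add: \<kappa>_def)
  have ub: "\<bar>u i j\<bar> \<le> \<beta>" and vb: "\<bar>v i j\<bar> \<le> \<beta>" for i j
    using u[of i j] v[of i j] C0 S(2)
    by (simp_all add: \<beta>_def C_def[symmetric] field_simps)
  define X where "X = (\<lambda>k l. z k l * u k l - \<kappa> * eth_x S z k l)"
  define Y where "Y = (\<lambda>k l. z k l * v k l - \<kappa> * eth_y S z k l)"
  have pX: "grid_periodic S X" and pY: "grid_periodic S Y"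
    unfolding X_def Y_def
    by (intro periodic_comp2[where f = minus] periodic_comp2[where f = times] periodic_const periodic_eth per)+
  have "0 = (\<Sum>(i,j)\<in>cells S. z i j * height_op S u v z i j)"
    by (simp add: L)
  also have "\<dots> = (\<Sum>(i,j)\<in>cells S. (z i j)\<^sup>2 / \<Delta>t S + z i j * eth_x S X i j + z i j * eth_y S Y i j)"
    by (intro sum.cong) (auto simp: height_op_def X_def Y_def \<kappa>_def distrib_left power2_eq_square)
  also have "\<dots> = E / \<Delta>t S - (\<Sum>(i,j)\<in>cells S. eth_x S z i j * X i j) - (\<Sum>(i,j)\<in>cells S. eth_y S z i j * Y i j)"
    using sum_cells_by_parts(1)[OF per(3) pX] sum_cells_by_parts(2)[OF per(3) pY]
    by (simp add: split_def sum.distrib E_def flip: sum_divide_distrib)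
  finally have E: "E / \<Delta>t S = (\<Sum>(i,j)\<in>cells S. eth_x S z i j * X i j) + (\<Sum>(i,j)\<in>cells S. eth_y S z i j * Y i j)"
    by simp
  \<comment> \<open>dropping \<open>- \<kappa> (\<eth>\<^sub>x z)\<^sup>2\<close>: the stabilisation only helps\<close>
  have "(\<Sum>(i,j)\<in>cells S. eth_x S z i j * X i j) \<le> (\<Sum>(i,j)\<in>cells S. eth_x S z i j * (z i j * u i j))"
    using k0 by (intro sum_mono) (auto simp: X_def right_diff_distrib mult.left_commute)
  also have "\<dots> \<le> \<beta> / \<Delta>x S * E"
    unfolding E_def by (rule sum_cells_transport_bound(1)[OF per(3) ub pos(1,2)])
  finally have 1: "(\<Sum>(i,j)\<in>cells S. eth_x S z i j * X i j) \<le> \<beta> / \<Delta>x S * E" .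
  have "(\<Sum>(i,j)\<in>cells S. eth_y S z i j * Y i j) \<le> (\<Sum>(i,j)\<in>cells S. eth_y S z i j * (z i j * v i j))"
    using k0 by (intro sum_mono) (auto simp: Y_def right_diff_distrib mult.left_commute)
  also have "\<dots> \<le> \<beta> / \<Delta>y S * E"
    unfolding E_def by (rule sum_cells_transport_bound(2)[OF per(3) vb pos(1,2)])
  finally have 2: "(\<Sum>(i,j)\<in>cells S. eth_y S z i j * Y i j) \<le> \<beta> / \<Delta>y S * E" .
  have "E / \<Delta>t S \<le> \<beta> / \<Delta>x S * E + \<beta> / \<Delta>y S * E"
    using E 1 2 by linarith
  also have "\<dots> = \<beta> * (C / 2) * E" by (simp add: C_def algebra_simps)
  also have "\<dots> = E / \<Delta>t S / 2" using C0 S(2) by (simp add: \<beta>_def)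
  finally have "E \<le> 0" using S(2) by (simp add: field_simps)
  moreover have "E \<ge> 0" unfolding E_def by (intro sum_nonneg) auto
  ultimately have "E = 0" by simp
  then have z0: "z i j = 0" if "(i, j) \<in> cells S" for i j
    using that unfolding E_def by (subst (asm) sum_nonneg_eq_0_iff) auto
  have "z i j = 0" for i j
    using pos by (subst periodic_mod[OF per(3)]) (intro z0, auto)
  then show ?thesis by (simp add: fun_eq_iff)
qed

section \<open>Solvability of the mass balance\<close>

text \<open>
  Stated for the span of a finite set, since the space of all grid functions has infinite
  dimension. The image of a basis \<open>B\<close> is independent; a vector outside its span would yield
  \<open>card B + 1\<close> independent vectors in the span of \<open>B\<close>.
\<close>

lemma (in vector_space) linear_inj_on_span_imp_surj:
  assumes "finite D" and lin: "Vector_Spaces.linear scale scale T"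
    and maps: "T ` span D \<subseteq> span D" and inj: "inj_on T (span D)"
  shows "T ` span D = span D"
proof
  interpret pair: vector_space_pair scale scale by unfold_locales
  obtain B where B: "B \<subseteq> D" "independent B" "D \<subseteq> span B"
    using maximal_independent_subset by blast
  have sp: "span B = span D"
    using B by (meson antisym span_minimal span_mono subspace_span)
  have fin: "finite B" using B assms(1) finite_subset by blast
  have ind: "independent (T ` B)"
    using pair.linear_independent_injective_image[OF lin B(2)] inj sp by simp
  have card: "card (T ` B) = card B"
    using inj B(1) span_superset sp by (intro card_image) (metis inj_on_subset)
  have im: "span (T ` B) = T ` span D"
    using pair.linear_span_image[OF lin, of B] sp by simp
  show "span D \<subseteq> T ` span D"
  proof
    fix y assume y: "y \<in> span D"
    show "y \<in> T ` span D"
    proof (rule ccontr)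
      assume "y \<notin> T ` span D"
      then have ny: "y \<notin> span (T ` B)" by (simp add: im)
      have "T ` B \<subseteq> span B" using maps sp span_superset by blast
      then have "card (insert y (T ` B)) \<le> card B"
        using independent_span_bound[OF fin independent_insertI[OF ny ind]] y sp by auto
      moreover have "y \<notin> T ` B" using ny span_superset by blast
      ultimately show False using card fin by simp
    qed
  qed
qed (fact maps)

definition grid_scale :: "real \<Rightarrow> grid \<Rightarrow> grid" where
  "grid_scale c z = (\<lambda>i j. c * z i j)"

interpretation grid: vector_space grid_scale
  by unfold_locales (simp_all add: grid_scale_def fun_eq_iff algebra_simps)

definition cell_indicator :: "swe \<Rightarrow> int \<times> int \<Rightarrow> grid" where
  "cell_indicator S c i j =
     (if (i mod int (cells_x S), j mod int (cells_y S)) = c then 1 else 0)"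

lemma sum_grid_apply: "(\<Sum>c\<in>A. f c) i j = (\<Sum>c\<in>A. (f c :: grid) i j)"
  by (induction A rule: infinite_finite_induct) auto

lemma span_cell_indicators:
  assumes "cells_x S \<ge> 1" "cells_y S \<ge> 1"
  shows "grid.span (cell_indicator S ` cells S) = {z. grid_periodic S z}"
proof
  have "grid.subspace {z. grid_periodic S z}"
    by (auto simp: grid.subspace_def grid_periodic_def grid_scale_def)
  moreover have "cell_indicator S ` cells S \<subseteq> {z. grid_periodic S z}"
    by (auto simp: grid_periodic_def cell_indicator_def)
  ultimately show "grid.span (cell_indicator S ` cells S) \<subseteq> {z. grid_periodic S z}"
    by (rule grid.span_minimal[rotated])
next
  show "{z. grid_periodic S z} \<subseteq> grid.span (cell_indicator S ` cells S)"
  proof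
    fix z assume "z \<in> {z. grid_periodic S z}"
    then have z: "grid_periodic S z" by simp
    have "z = (\<Sum>c\<in>cells S. grid_scale (z (fst c) (snd c)) (cell_indicator S c))"
    proof (intro ext)
      fix i j
      define c0 where "c0 = (i mod int (cells_x S), j mod int (cells_y S))"
      have c0: "c0 \<in> cells S" using assms by (auto simp: c0_def)
      have "(\<Sum>c\<in>cells S. grid_scale (z (fst c) (snd c)) (cell_indicator S c)) i j
          = (\<Sum>c\<in>cells S. if c0 = c then z (fst c) (snd c) else 0)"
        unfolding sum_grid_apply
        by (intro sum.cong) (auto simp: grid_scale_def cell_indicator_def c0_def)
      also have "\<dots> = z (fst c0) (snd c0)" using c0 by (subst sum.delta') auto
      also have "\<dots> = z i j" using periodic_mod[OF z, of i j] by (simp add: c0_def)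
      finally show "z i j = (\<Sum>c\<in>cells S. grid_scale (z (fst c) (snd c)) (cell_indicator S c)) i j" by simp
    qed
    also have "\<dots> \<in> grid.span (cell_indicator S ` cells S)"
      by (intro grid.span_sum grid.span_scale grid.span_base) auto
    finally show "z \<in> grid.span (cell_indicator S ` cells S)" .
  qed
qed

lemma linear_height_op: "Vector_Spaces.linear grid_scale grid_scale (height_op S u v)"
proof -
  interpret vector_space_pair grid_scale grid_scale by unfold_locales
  show ?thesis
    by (unfold_locales; intro ext)
       (simp_all add: height_op_def eth_x_central eth_y_central grid_scale_def
          algebra_simps add_divide_distrib diff_divide_distrib)
qed

lemma ex1_mass_balance:
  assumes S: "swe_setting S" "\<Delta>t S > 0"
    and per: "grid_periodic S h" "grid_periodic S u" "grid_periodic S v"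
    and u: "\<And>i j. \<Delta>t S * (2 / \<Delta>x S + 2 / \<Delta>y S) * \<bar>u i j\<bar> \<le> 1"
    and v: "\<And>i j. \<Delta>t S * (2 / \<Delta>x S + 2 / \<Delta>y S) * \<bar>v i j\<bar> \<le> 1"
  shows "\<exists>!h'. grid_periodic S h' \<and> mass_balance S h u v h'"
proof -
  interpret pair: vector_space_pair grid_scale grid_scale by unfold_locales
  define D where "D = cell_indicator S ` cells S"
  have sp: "grid.span D = {z. grid_periodic S z}"
    unfolding D_def by (rule span_cell_indicators) (use S in \<open>auto simp: swe_setting_def\<close>)
  have inj: "inj_on (height_op S u v) (grid.span D)"
    using height_op_kernel_trivial[OF S per(2,3) _ u v]
    by (subst pair.linear_inj_on_iff_eq_0[OF linear_height_op grid.subspace_span])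
       (auto simp: sp zero_fun_def)
  have "height_op S u v ` grid.span D = grid.span D"
    by (rule grid.linear_inj_on_span_imp_surj[OF _ linear_height_op _ inj])
       (use periodic_height_op[OF per(2,3)] in \<open>auto simp: D_def[symmetric] sp, simp add: D_def\<close>)
  moreover have "height_rhs S h u v \<in> grid.span D"
    using periodic_height_rhs[OF S(1) per] sp by simp
  ultimately obtain h' where "h' \<in> grid.span D" "height_op S u v h' = height_rhs S h u v"
    by (metis imageE)
  with inj show ?thesis
    unfolding mass_balance_iff_height_op by (intro ex1I[of _ h']) (auto simp: sp inj_on_def)
qed

section \<open>The scheme\<close>

text \<open>
  The positive maxima make the root nonnegative, so the velocity term alone obeys the bound 1.
\<close>

lemma time_step_restriction_velocity:
  assumes "time_step_restriction S h u v h'" "swe_setting S" "\<Delta>t S > 0"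
  shows "\<Delta>t S * (2 / \<Delta>x S + 2 / \<Delta>y S) * \<bar>u i j\<bar> \<le> 1"
    and "\<Delta>t S * (2 / \<Delta>x S + 2 / \<Delta>y S) * \<bar>v i j\<bar> \<le> 1"
proof -
  define C where "C = \<Delta>t S * (2 / \<Delta>x S + 2 / \<Delta>y S)"
  have pos: "C \<ge> 0" "stab S > 0" using assms by (auto simp: swe_setting_def C_def)
  have x: "max (h' i j) (h' (i + 1) j) > 0"
      "C * (max \<bar>u i j\<bar> \<bar>u (i + 1) j\<bar> + sqrt (stab S / max (h' i j) (h' (i + 1) j)) * Lambda_x S v h' i j) < 1"
    and y: "max (h' i j) (h' i (j + 1)) > 0"
      "C * (max \<bar>v i j\<bar> \<bar>v i (j + 1)\<bar> + sqrt (stab S / max (h' i j) (h' i (j + 1))) * Lambda_y S u h' i j) < 1"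
    using assms(1) unfolding time_step_restriction_def Let_def C_def min_less_iff_conj by blast+
  have "Lambda_x S v h' i j \<ge> 0" "Lambda_y S u h' i j \<ge> 0"
    by (auto simp: Lambda_x_def Lambda_y_def)
  then have n: "sqrt (stab S / max (h' i j) (h' (i + 1) j)) * Lambda_x S v h' i j \<ge> 0"
    "sqrt (stab S / max (h' i j) (h' i (j + 1))) * Lambda_y S u h' i j \<ge> 0"
    using x(1) y(1) pos by (auto intro!: mult_nonneg_nonneg real_sqrt_ge_zero divide_nonneg_pos)
  have "C * \<bar>u i j\<bar> \<le> C * (max \<bar>u i j\<bar> \<bar>u (i + 1) j\<bar> + sqrt (stab S / max (h' i j) (h' (i + 1) j)) * Lambda_x S v h' i j)"
    using n pos by (intro mult_left_mono) linarith+
  with x show "\<Delta>t S * (2 / \<Delta>x S + 2 / \<Delta>y S) * \<bar>u i j\<bar> \<le> 1" by (simp add: C_def)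
  have "C * \<bar>v i j\<bar> \<le> C * (max \<bar>v i j\<bar> \<bar>v i (j + 1)\<bar> + sqrt (stab S / max (h' i j) (h' i (j + 1))) * Lambda_y S u h' i j)"
    using n pos by (intro mult_left_mono) linarith+
  with y show "\<Delta>t S * (2 / \<Delta>x S + 2 / \<Delta>y S) * \<bar>v i j\<bar> \<le> 1" by (simp add: C_def)
qed

lemma ex_scheme_step:
  assumes S: "swe_setting S" "\<Delta>t S > 0"
    and per: "grid_periodic S h" "grid_periodic S u" "grid_periodic S v" "grid_periodic S h'"
    and mb: "mass_balance S h u v h'" and pos: "grid_pos h'"
  shows "\<exists>u' v'. scheme_step S h u v h' u' v'"
proof -
  define F where "F = flux_F S u v h'"
  define G where "G = flux_G S u v h'"
  define transport where "transport w i j =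
      (F i j * upwind_x F w i j - F (i - 1) j * upwind_x F w (i - 1) j) / \<Delta>x S
      + (G i j * upwind_y G w i j - G i (j - 1) * upwind_y G w i (j - 1)) / \<Delta>y S" for w i j
  define u' where "u' i j = (h i j * u i j + \<Delta>t S * (coriolis S * h' i j * v i j - coriolis S * stab_r S u h' i j
      - h' i j * eth_x S (potential S h') i j - transport u i j)) / h' i j" for i j
  define v' where "v' i j = (h i j * v i j + \<Delta>t S * (- coriolis S * h' i j * u i j + coriolis S * stab_q S v h' i j
      - h' i j * eth_y S (potential S h') i j - transport v i j)) / h' i j" for i j
  have FG: "grid_periodic S F" "grid_periodic S G"
    unfolding F_def G_def by (rule periodic_fluxes[OF S(1) per(2-4)])+
  have tp: "grid_periodic S (transport w)" if "grid_periodic S w" for w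
    using FG[THEN periodic_prev(1)] FG[THEN periodic_prev(2)] FG
      periodic_upwind(1)[OF FG(1) that] periodic_upwind(2)[OF FG(2) that]
      periodic_upwind(1)[OF FG(1) that, THEN periodic_prev(1)]
      periodic_upwind(2)[OF FG(2) that, THEN periodic_prev(2)]
    by (simp add: grid_periodic_def transport_def)
  have "grid_periodic S u'" "grid_periodic S v'"
    using per tp[OF per(2)] tp[OF per(3)] periodic_eth[OF periodic_potential[OF S(1) per(4)]]
      periodic_stab(1)[OF S(1) per(3,4)] periodic_stab(2)[OF S(1) per(2,4)]
    by (simp_all add: grid_periodic_def u'_def v'_def)
  moreover have ne: "h' i j \<noteq> 0" for i j using pos by (simp add: grid_pos_def less_imp_neq[symmetric])
  have "momentum_x S h u v h' u'"
    unfolding momentum_x_def Let_def F_def[symmetric] G_def[symmetric]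
  proof (intro allI)
    fix i j
    have "(h' i j * u' i j - h i j * u i j) / \<Delta>t S = coriolis S * h' i j * v i j - coriolis S * stab_r S u h' i j
      - h' i j * eth_x S (potential S h') i j - transport u i j"
      using S(2) ne by (simp add: u'_def)
    then show "(h' i j * u' i j - h i j * u i j) / \<Delta>t S
        + (F i j * upwind_x F u i j - F (i - 1) j * upwind_x F u (i - 1) j) / \<Delta>x S
        + (G i j * upwind_y G u i j - G i (j - 1) * upwind_y G u i (j - 1)) / \<Delta>y S
        + h' i j * eth_x S (potential S h') i j
        = coriolis S * h' i j * v i j - coriolis S * stab_r S u h' i j"
      by (simp add: transport_def)
  qed
  moreover have "momentum_y S h u v h' v'"
    unfolding momentum_y_def Let_def F_def[symmetric] G_def[symmetric]
  proof (intro allI)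
    fix i j
    have "(h' i j * v' i j - h i j * v i j) / \<Delta>t S = - coriolis S * h' i j * u i j + coriolis S * stab_q S v h' i j
      - h' i j * eth_y S (potential S h') i j - transport v i j"
      using S(2) ne by (simp add: v'_def)
    then show "(h' i j * v' i j - h i j * v i j) / \<Delta>t S
        + (F i j * upwind_x F v i j - F (i - 1) j * upwind_x F v (i - 1) j) / \<Delta>x S
        + (G i j * upwind_y G v i j - G i (j - 1) * upwind_y G v i (j - 1)) / \<Delta>y S
        + h' i j * eth_y S (potential S h') i j
        = - coriolis S * h' i j * u i j + coriolis S * stab_q S v h' i j"
      by (simp add: transport_def)
  qed
  ultimately show ?thesis using per(4) mb unfolding scheme_step_def by blast
qed

theorem theorem1p7:
  shows "\<exists>\<delta>0 > (0::real). \<forall>(S :: swe) (h :: nat \<Rightarrow> grid) (u :: nat \<Rightarrow> grid) (v :: nat \<Rightarrow> grid).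
    swe_setting S \<and> mesh_size S \<le> \<delta>0 \<longrightarrow>
      (\<forall>n < time_steps S.
         grid_periodic S (h n) \<and> grid_periodic S (u n) \<and> grid_periodic S (v n) \<and>
         grid_pos (h n) \<and>
         time_step_restriction S (h n) (u n) (v n) (next_height S (h n) (u n) (v n))
         \<longrightarrow> (\<exists>h' u' v'. scheme_step S (h n) (u n) (v n) h' u' v' \<and> grid_pos h'))
      \<and>
      (h 0 = cell_average S (h_init S) \<and>
       u 0 = cell_average S (u_init S) \<and>
       v 0 = cell_average S (v_init S) \<and>
       grid_pos (h 0) \<and>
       (\<forall>n < time_steps S.
          scheme_step S (h n) (u n) (v n) (h (Suc n)) (u (Suc n)) (v (Suc n)) \<and>
          time_step_restriction S (h n) (u n) (v n) (h (Suc n)))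
       \<longrightarrow> (\<forall>n. 1 \<le> n \<and> n \<le> time_steps S \<longrightarrow> grid_pos (h n)))"
  (* the mesh size 1 is small enough, as it gives 2/dx >= 2 *)
proof (rule exI[of _ 1], intro conjI allI impI; (elim conjE)?)
  show "(0::real) < 1" by simp
next
  fix S :: swe and h u v :: "nat \<Rightarrow> grid" and n
  assume S: "swe_setting S" "mesh_size S \<le> 1"
    and per: "grid_periodic S (h n)" "grid_periodic S (u n)" "grid_periodic S (v n)"
    and pos: "grid_pos (h n)"
    and cfl: "time_step_restriction S (h n) (u n) (v n) (next_height S (h n) (u n) (v n))"
  have sp: "\<Delta>x S > 0" "\<Delta>y S > 0" "stab S > 0" and dt: "\<Delta>t S > 0"
    using S by (auto simp: swe_setting_def \<Delta>t_def)
  define h' where "h' = next_height S (h n) (u n) (v n)"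
  have "grid_periodic S h' \<and> mass_balance S (h n) (u n) (v n) h'"
    unfolding h'_def next_height_def
    by (rule theI'[OF ex1_mass_balance[OF S(1) dt per time_step_restriction_velocity[OF cfl S(1) dt]]])
  moreover from this have "grid_pos h'"
    using mass_balance_imp_pos[OF dt sp mesh_factor_ge_1[OF S]] pos cfl unfolding h'_def by blast
  ultimately show "\<exists>h' u' v'. scheme_step S (h n) (u n) (v n) h' u' v' \<and> grid_pos h'"
    using ex_scheme_step[OF S(1) dt per] by blast
next
  fix S :: swe and h u v :: "nat \<Rightarrow> grid" and n
  assume S: "swe_setting S" "mesh_size S \<le> 1"
    and h0: "grid_pos (h 0)" and n: "n \<le> time_steps S"
    and step: "\<forall>n < time_steps S.
          scheme_step S (h n) (u n) (v n) (h (Suc n)) (u (Suc n)) (v (Suc n)) \<and>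
          time_step_restriction S (h n) (u n) (v n) (h (Suc n))"
  have sp: "\<Delta>x S > 0" "\<Delta>y S > 0" "stab S > 0" and dt: "\<Delta>t S > 0"
    using S by (auto simp: swe_setting_def \<Delta>t_def)
  from n show "grid_pos (h n)"
  proof (induction n)
    case (Suc n)
    then show ?case
      using mass_balance_imp_pos[OF dt sp mesh_factor_ge_1[OF S]] step
      unfolding scheme_step_def Suc_le_eq by (meson less_imp_le)
  qed (use h0 in simp)
qed

end
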